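(* Let $(T,X,\mu)$ be an ergodic measure-preserving dynamical system with $\mu$ a probability measure, let $\phi:X\to\mathbb{R}$ be an observable, let $k\ge 1$ be an integer, and let $Y=\min\{\phi,\phi\circ T,\ldots,\phi\circ T^{k-1}\}$ or $Y=\frac1k\sum_{j=0}^{k-1}\phi\circ T^j$. Put $M_n=\max\{\phi,\phi\circ T,\ldots,\phi\circ T^{n-1}\}$ and $B_n=\max_{1\le j\le n-1}Y_j$, where $Y_j=Y\circ T^j$. Let $\theta_1,\theta_2\in(0,1]$ and let $g(k,T)>0$ be a constant depending on $k$ and on the system $(T,X,\mu)$ (not on $n$ or $\tau$). (a) (Fréchet case) Suppose $\phi$ has a Fréchet distribution with shape $\xi_1>0$, with linear scaling $u_n(\tau)=a_n\tau^{-\xi_1}$, $a_n>0$, and that for every $\tau>0$ $$\mu(M_n\le u_n(\tau))\to e^{-\theta_1\tau},\qquad \mu(B_n\le w_n(\tau))\to e^{-\theta_2\tau}.$$ If $w_n(\tau)=g(k,T)\,u_n(\tau)$, then the GEV parameters $(\xi_1,\sigma_1,\mu_1)$ of $M_n$ and $(\xi_2,\sigma_2,\mu_2)$ of $B_n$ (for the same fixed large $n$) satisfy $$\xi_2=\xi_1,\qquad \mu_2=g(k,T)\,\mu_1\left(\frac{\theta_2}{\theta_1}\right)^{\xi_1},\qquad \sigma_2=g(k,T)\,\sigma_1\left(\frac{\theta_2}{\theta_1}\right)^{\xi_1}.$$ (b) (Weibull case) Suppose $\phi$ has a Weibull distribution with shape $\xi_1<0$, that $C$ is the supremum of the range of $\phi$,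 and that for every $\tau>0$ $$\mu(M_n\le u_n(\tau))\to e^{-\theta_1\tau},\qquad \mu(B_n\le w_n(\tau))\to e^{-\theta_2\tau},$$ where $u_n(\tau)=a_n\rho(\tau)+C$, $w_n(\tau)=\alpha_n\rho(\tau)+C$, with $\rho(\tau)=-\tau^{-\xi_1}$, $a_n>0$ and $\alpha_n=g(k,T)\,a_n$. Then the GEV parameters $(\xi_1,\sigma_1,\mu_1)$ of $M_n$ and $(\xi_2,\sigma_2,\mu_2)$ of $B_n$ (for the same fixed large $n$) satisfy $$\xi_2=\xi_1,\qquad \mu_2=\frac{\sigma_1}{\xi_1}\bigl(g(k,T)-1\bigr)+\mu_1-\frac{g(k,T)\,\sigma_1}{\xi_1}\left(1-\left(\frac{\theta_2}{\theta_1}\right)^{\xi_1}\right),\qquad \sigma_2=g(k,T)\,\sigma_1\left(\frac{\theta_2}{\theta_1}\right)^{\xi_1}.$$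
   Context: The symbol $\mu$ without subscript is the invariant probability measure; $\mu_1,\mu_2$ are real location parameters. The generalized extreme value (GEV) distribution with shape $\xi\ne0$, scale $\sigma>0$ and location $m\in\mathbb{R}$ is $z\mapsto\exp\{-[1+\xi(\frac{z-m}{\sigma})]^{-1/\xi}\}$ on $\{z:1+\xi(z-m)/\sigma>0\}$. It is of Fréchet type if $\xi>0$ and of Weibull type if $\xi<0$. GEV parameters of a maximal process at fixed large $n$: suppose a maximal process $Z_n$ satisfies $\mu(Z_n\le c_nt+b)\to G^{\theta}(t)$ with $c_n>0$, where in the Fréchet case $b=0$, $G(t)=\exp(-t^{-1/\xi})$ for $t>0$ ($\xi>0$), and in the Weibull case $b=C$, $G(t)=\exp(-(-t)^{-1/\xi})$ for $t\le 0$ ($\xi<0$). Then for fixed large $n$ the law of $Z_n$ is approximated by $\mu(Z_n\le z)\approx G^{\theta}((z-b)/c_n)$, and the GEV parameters of $Z_n$ are the (n-dependent) numbers (shape, scale, location) for which $z\mapsto G^{\theta}((z-b)/c_n)$ equals the GEV distribution function in the standard form above. Here $t=\tau^{-\xi_1}$ in the Fréchet case and $t=-\tau^{-\xi_1}$ in the Weibull case. *)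

theory Defs
  imports "HOL-Probability.Probability"
begin

locale ergodic_system = prob_space P for P :: "'a measure" +
  fixes T :: "'a \<Rightarrow> 'a"
  assumes T_measurable: "T \<in> measurable P P"
    and T_preserving: "\<And>A. A \<in> sets P \<Longrightarrow> measure P (T -` A \<inter> space P) = measure P A"
    and T_ergodic: "\<And>A. A \<in> sets P \<Longrightarrow> T -` A \<inter> space P = A \<Longrightarrow>
      measure P A = 0 \<or> measure P A = 1"

definition window_min :: "('a \<Rightarrow> 'a) \<Rightarrow> ('a \<Rightarrow> real) \<Rightarrow> nat \<Rightarrow> 'a \<Rightarrow> real" where
  "window_min T \<phi> k x = Min ((\<lambda>j. \<phi> ((T ^^ j) x)) ` {..<k})"

definition window_mean :: "('a \<Rightarrow> 'a) \<Rightarrow> ('a \<Rightarrow> real) \<Rightarrow> nat \<Rightarrow> 'a \<Rightarrow> real" where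
  "window_mean T \<phi> k x = (1 / real k) * (\<Sum>j<k. \<phi> ((T ^^ j) x))"

text \<open>The two maxima are meaningful for \<open>n \<ge> 1\<close> and \<open>n \<ge> 2\<close> respectively; the second
  one starts at the index \<open>1\<close>.\<close>

definition orbit_max :: "('a \<Rightarrow> 'a) \<Rightarrow> ('a \<Rightarrow> real) \<Rightarrow> nat \<Rightarrow> 'a \<Rightarrow> real" where
  "orbit_max T \<phi> n x = Max ((\<lambda>j. \<phi> ((T ^^ j) x)) ` {0..n - 1})"

definition window_max :: "('a \<Rightarrow> 'a) \<Rightarrow> ('a \<Rightarrow> real) \<Rightarrow> nat \<Rightarrow> 'a \<Rightarrow> real" where
  "window_max T Y n x = Max ((\<lambda>j. Y ((T ^^ j) x)) ` {1..n - 1})"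

definition cdf_of :: "'a measure \<Rightarrow> ('a \<Rightarrow> real) \<Rightarrow> real \<Rightarrow> real" where
  "cdf_of P Z z = measure P {x \<in> space P. Z x \<le> z}"

text \<open>Outside the support \<open>{z. 1 + \<xi> * (z - m) / \<sigma> > 0}\<close> the distribution function is
  continued by \<open>0\<close> (below a Frechet support) or \<open>1\<close> (above a Weibull support).\<close>

definition gev_cdf :: "real \<Rightarrow> real \<Rightarrow> real \<Rightarrow> real \<Rightarrow> real" where
  "gev_cdf \<xi> \<sigma> m z =
     (let y = 1 + \<xi> * ((z - m) / \<sigma>)
      in if 0 < y then exp (- (y powr (- 1 / \<xi>))) else if 0 < \<xi> then 0 else 1)"

text \<open>The standard Frechet (\<open>\<xi> > 0\<close>) and Weibull (\<open>\<xi> < 0\<close>) laws \<open>G\<close>, and the range of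
  the variable \<open>t\<close> on which limits towards them are taken.\<close>

definition std_ev_cdf :: "real \<Rightarrow> real \<Rightarrow> real" where
  "std_ev_cdf \<xi> t =
     (if 0 < \<xi> then (if 0 < t then exp (- (t powr (- 1 / \<xi>))) else 0)
      else (if t \<le> 0 then exp (- ((- t) powr (- 1 / \<xi>))) else 1))"

definition ev_range :: "real \<Rightarrow> real set" where
  "ev_range \<xi> = (if 0 < \<xi> then {0<..} else {..0})"

definition max_limit_law ::
  "'a measure \<Rightarrow> (nat \<Rightarrow> 'a \<Rightarrow> real) \<Rightarrow> (nat \<Rightarrow> real) \<Rightarrow> real \<Rightarrow> real \<Rightarrow> real \<Rightarrow> bool" where
  "max_limit_law P Z c b \<xi> \<theta> \<longleftrightarrow>
     \<xi> \<noteq> 0 \<and> 0 < \<theta> \<and> \<theta> \<le> 1 \<and> (\<forall>n. 0 < c n) \<and>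
     (\<forall>t\<in>ev_range \<xi>. (\<lambda>n. cdf_of P (Z n) (c n * t + b)) \<longlonglongrightarrow> std_ev_cdf \<xi> t powr \<theta>)"

text \<open>The triple (shape, scale, location) for which \<open>z \<mapsto> G\<^sup>\<theta> ((z - b) / c\<^sub>n)\<close>, the
  approximation of the law of \<open>Z\<^sub>n\<close> at the fixed time \<open>n\<close>, is the GEV distribution
  function. The data \<open>\<xi>, \<theta>\<close> of the limit law are not parameters, they are
  determined by the process and its normalisation.\<close>

definition gev_params ::
  "'a measure \<Rightarrow> (nat \<Rightarrow> 'a \<Rightarrow> real) \<Rightarrow> (nat \<Rightarrow> real) \<Rightarrow> real \<Rightarrow> nat \<Rightarrow> real \<times> real \<times> real \<Rightarrow> bool"
where
  "gev_params P Z c b n = (\<lambda>(s, \<sigma>, m).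
     s \<noteq> 0 \<and> 0 < \<sigma> \<and>
     (\<exists>\<xi> \<theta>. max_limit_law P Z c b \<xi> \<theta> \<and>
        (\<forall>z. std_ev_cdf \<xi> ((z - b) / c n) powr \<theta> = gev_cdf s \<sigma> m z)))"

text \<open>The distribution function \<open>F\<close> of \<open>\<phi>\<close> is of type \<open>\<xi>\<close> if \<open>F\<^sup>n\<close>, suitably
  normalised, converges to the standard law. The two lemmas below show that this covers both
  current meanings of the phrase: \<open>F\<close> is itself a GEV distribution function with shape \<open>\<xi>\<close>,
  or \<open>n * \<mu>(\<phi> > u\<^sub>n(\<tau>)) \<longlonglongrightarrow> \<tau>\<close> for the linear scaling \<open>u\<^sub>n(\<tau>)\<close>.\<close>

definition has_ev_type :: "'a measure \<Rightarrow> ('a \<Rightarrow> real) \<Rightarrow> real \<Rightarrow> bool" where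
  "has_ev_type P \<phi> \<xi> \<longleftrightarrow> \<xi> \<noteq> 0 \<and>
     (\<exists>c d. (\<forall>n. 0 < c n) \<and>
        (\<forall>t\<in>ev_range \<xi>. (\<lambda>n. cdf_of P \<phi> (c n * t + d n) ^ n) \<longlonglongrightarrow> std_ev_cdf \<xi> t))"

lemma has_ev_type_if_gev:
  assumes "\<xi> \<noteq> 0" "0 < \<sigma>" and F: "\<And>z. cdf_of P \<phi> z = gev_cdf \<xi> \<sigma> m z"
  shows "has_ev_type P \<phi> \<xi>"
proof -
  define c where "c n = (if n = 0 then 1 else \<sigma> * real n powr \<xi> / \<bar>\<xi>\<bar>)" for n :: nat
  have c: "0 < c n" for n using assms by (simp add: c_def)
  have y: "1 + \<xi> * ((c n * t + (m - \<sigma> / \<xi>) - m) / \<sigma>) = sgn \<xi> * (real n powr \<xi> * t)"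
    if "n > 0" for n t
    using assms(1,2) that by (auto simp: c_def field_simps sgn_if abs_if)
  have e: "cdf_of P \<phi> (c n * t + (m - \<sigma> / \<xi>)) ^ n = std_ev_cdf \<xi> t"
    if n: "n > 0" and t: "t \<in> ev_range \<xi>" for n t
  proof -
    define r where "r = \<bar>t\<bar>"
    have s: "sgn \<xi> * (real n powr \<xi> * t) = real n powr \<xi> * r"
      using t assms(1) by (auto simp: r_def ev_range_def sgn_if split: if_splits)
    have p: "real n * (real n powr \<xi> * r) powr (- 1 / \<xi>) = r powr (- 1 / \<xi>)"
    proof -
      have "(real n powr \<xi> * r) powr (- 1 / \<xi>)
          = (real n powr \<xi>) powr (- 1 / \<xi>) * r powr (- 1 / \<xi>)"
        by (rule powr_mult)
      also have "(real n powr \<xi>) powr (- 1 / \<xi>) = real n powr (- 1)"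
        using assms(1) by (simp add: powr_powr)
      also have "real n powr (- 1) = 1 / real n" using n by (simp add: powr_minus_divide)
      finally show ?thesis using n by simp
    qed
    have "cdf_of P \<phi> (c n * t + (m - \<sigma> / \<xi>)) =
       (if 0 < r then exp (- ((real n powr \<xi> * r) powr (- 1 / \<xi>))) else if 0 < \<xi> then 0 else 1)"
      unfolding F gev_cdf_def y[OF n] s Let_def using n by (auto simp: zero_less_mult_iff)
    then show ?thesis
      using n t assms(1) p
      by (auto simp: std_ev_cdf_def ev_range_def r_def exp_of_nat_mult[symmetric] split: if_splits)
  qed
  have "(\<lambda>n. cdf_of P \<phi> (c n * t + (m - \<sigma> / \<xi>)) ^ n) \<longlonglongrightarrow> std_ev_cdf \<xi> t"
    if t: "t \<in> ev_range \<xi>" for t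
    by (rule tendsto_eventually, rule eventually_mono[OF eventually_gt_at_top[of 0]])
       (use e t in blast)
  then show ?thesis unfolding has_ev_type_def using assms(1) c
    by (intro conjI exI[of _ c] exI[of _ "\<lambda>_. m - \<sigma> / \<xi>"]) auto
qed

lemma power_tendsto_exp_minus:
  fixes p :: "nat \<Rightarrow> real"
  assumes p0: "\<And>n. 0 \<le> p n" and lim: "(\<lambda>n. real n * p n) \<longlonglongrightarrow> \<tau>"
  shows "(\<lambda>n. (1 - p n) ^ n) \<longlonglongrightarrow> exp (- \<tau>)"
proof -
  have "(\<lambda>n. (real n * p n) * (1 / real n)) \<longlonglongrightarrow> \<tau> * 0"
    by (intro tendsto_mult lim lim_1_over_n)
  moreover have "eventually (\<lambda>n. (real n * p n) * (1 / real n) = p n) sequentially"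
    using eventually_gt_at_top[of 0] by eventually_elim simp
  ultimately have p: "p \<longlonglongrightarrow> 0"
    using filterlim_cong[of "nhds (0::real)" "nhds 0"] by (force simp: tendsto_cong)
  have ev: "eventually (\<lambda>n. p n < 1) sequentially"
    using order_tendstoD(2)[OF p, of 1] by simp
  have lo: "(\<lambda>n. exp (- (real n * p n / (1 - p n)))) \<longlonglongrightarrow> exp (- (\<tau> / (1 - 0)))"
    by (intro tendsto_intros lim p) simp
  have hi: "(\<lambda>n. exp (- (real n * p n))) \<longlonglongrightarrow> exp (- \<tau>)"
    by (intro tendsto_intros lim)
  show ?thesis
  proof (rule tendsto_sandwich[OF _ _ _ hi])
    show "(\<lambda>n. exp (- (real n * p n / (1 - p n)))) \<longlonglongrightarrow> exp (- \<tau>)" using lo by simp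
    show "\<forall>\<^sub>F n in sequentially. (1 - p n) ^ n \<le> exp (- (real n * p n))"
      using ev
    proof eventually_elim
      case (elim n)
      have "(1 - p n) ^ n \<le> exp (- p n) ^ n"
        using exp_ge_add_one_self[of "- p n"] elim by (intro power_mono) auto
      then show ?case by (simp add: exp_of_nat_mult[symmetric])
    qed
    show "\<forall>\<^sub>F n in sequentially. exp (- (real n * p n / (1 - p n))) \<le> (1 - p n) ^ n"
      using ev
    proof eventually_elim
      case (elim n)
      have "1 / (1 - p n) = 1 + p n / (1 - p n)" using elim by (simp add: field_simps)
      also have "\<dots> \<le> exp (p n / (1 - p n))" by (rule exp_ge_add_one_self)
      finally have "exp (- (p n / (1 - p n))) \<le> 1 - p n"
        using elim by (simp add: exp_minus field_simps)
      then have "exp (- (p n / (1 - p n))) ^ n \<le> (1 - p n) ^ n" by (intro power_mono) auto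
      then show ?case by (simp add: exp_of_nat_mult[symmetric])
    qed
  qed
qed

lemma has_ev_type_if_tail:
  assumes "prob_space P" and \<phi>: "\<phi> \<in> borel_measurable P"
    and \<xi>: "\<xi> \<noteq> 0" and a: "\<And>n. 0 < a n"
    and C: "\<xi> < 0 \<Longrightarrow> (\<forall>x\<in>space P. \<phi> x \<le> C)"
    and tail: "\<And>\<tau>. 0 < \<tau> \<Longrightarrow>
      (\<lambda>n. real n * measure P {x \<in> space P. a n * (sgn \<xi> * \<tau> powr (- \<xi>)) + C < \<phi> x}) \<longlonglongrightarrow> \<tau>"
  shows "has_ev_type P \<phi> \<xi>"
proof -
  interpret prob_space P by fact
  have compl: "cdf_of P \<phi> z = 1 - measure P {x \<in> space P. z < \<phi> x}" for z
  proof -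
    have "{x \<in> space P. \<phi> x \<le> z} = space P - {x \<in> space P. z < \<phi> x}" by auto
    moreover have "{x \<in> space P. z < \<phi> x} \<in> sets P" using \<phi> by measurable
    ultimately show ?thesis unfolding cdf_of_def using prob_compl by metis
  qed
  have "(\<lambda>n. cdf_of P \<phi> (a n * t + C) ^ n) \<longlonglongrightarrow> std_ev_cdf \<xi> t" if t: "t \<in> ev_range \<xi>" for t
  proof (cases "t = 0")
    case True
    then have neg: "\<xi> < 0" using t \<xi> by (auto simp: ev_range_def split: if_splits)
    have "{x \<in> space P. \<phi> x \<le> C} = space P" using C[OF neg] by auto
    then show ?thesis using True neg by (simp add: cdf_of_def std_ev_cdf_def prob_space)
  next
    case False
    define \<tau> where "\<tau> = \<bar>t\<bar> powr (- 1 / \<xi>)"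
    have \<tau>: "0 < \<tau>" using False by (simp add: \<tau>_def)
    have "\<tau> powr (- \<xi>) = \<bar>t\<bar>" using \<xi> False by (simp add: \<tau>_def powr_powr)
    then have eq: "sgn \<xi> * \<tau> powr (- \<xi>) = t"
      using t \<xi> False by (auto simp: ev_range_def sgn_if split: if_splits)
    have "(\<lambda>n. cdf_of P \<phi> (a n * t + C) ^ n) \<longlonglongrightarrow> exp (- \<tau>)"
      unfolding compl by (rule power_tendsto_exp_minus) (use tail[OF \<tau>] eq in auto)
    moreover have "exp (- \<tau>) = std_ev_cdf \<xi> t"
      using t \<xi> False by (auto simp: ev_range_def std_ev_cdf_def \<tau>_def split: if_splits)
    ultimately show ?thesis by simp
  qed
  then show ?thesis unfolding has_ev_type_def using \<xi> a
    by (intro conjI exI[of _ a] exI[of _ "\<lambda>_. C"]) auto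
qed

end

(* By monotonicity of distribution functions, the normalised process determines the pair
   (\<xi>, \<theta>) of its limit law: in the Weibull case the limit at the endpoint b is 1, which is
   impossible in the Frechet case. Absorbing \<theta> into the scale then gives
   G^\<theta> ((z - b) / c) = exp (- ((\<bar>z - b\<bar> / (c * \<theta>^\<xi>))^(-1/\<xi>))) on the support, which is
   the GEV law of shape \<xi>, scale \<bar>\<xi>\<bar> * c * \<theta>^\<xi> and endpoint b, where the endpoint is
   location - scale / shape. Since GEV laws are identifiable, the parameters of M_n and B_n are
   explicit, and the claimed relations are algebra. *)

theory Submission
  imports Defs
begin

section \<open>Extreme value laws measured from the endpoint of their support\<close>

text \<open>With \<open>r\<close> the signed distance from the endpoint into the support, the
  Frechet and Weibull cases share one formula. At \<open>r = 0\<close> the Weibull value 1 comes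
  from \<open>0 powr x = 0\<close>.\<close>

lemma std_ev_cdf_powr:
  assumes "\<xi> \<noteq> 0" "0 < \<theta>"
  shows "std_ev_cdf \<xi> (sgn \<xi> * r) powr \<theta> =
    (if 0 < r then exp (- (\<theta> * r powr (- 1 / \<xi>))) else if 0 < \<xi> then 0 else 1)"
  using assms by (cases "r = 0") (auto simp: std_ev_cdf_def powr_def sgn_if)

text \<open>The affine term under the power vanishes at the endpoint
  \<open>m - \<sigma> / \<xi>\<close>, so in the distance \<open>r\<close> it is linear with slope
  \<open>\<bar>\<xi>\<bar> / \<sigma>\<close>.\<close>

lemma gev_cdf_endpoint:
  assumes "\<xi> \<noteq> 0" "0 < \<sigma>"
  shows "gev_cdf \<xi> \<sigma> m (m - \<sigma> / \<xi> + sgn \<xi> * r) =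
    (if 0 < r then exp (- ((\<bar>\<xi>\<bar> / \<sigma> * r) powr (- 1 / \<xi>))) else if 0 < \<xi> then 0 else 1)"
proof -
  have y: "1 + \<xi> * ((m - \<sigma> / \<xi> + sgn \<xi> * r - m) / \<sigma>) = \<bar>\<xi>\<bar> / \<sigma> * r"
    using assms by (auto simp: field_simps sgn_if abs_if)
  have "0 < \<bar>\<xi>\<bar> / \<sigma>" using assms by simp
  then have "0 < \<bar>\<xi>\<bar> / \<sigma> * r \<longleftrightarrow> 0 < r" by (metis zero_less_mult_pos mult_pos_pos)
  then show ?thesis unfolding gev_cdf_def Let_def y by simp
qed

text \<open>On the support the exponent is strictly negative, and elsewhere only the values 0 and 1
  occur. Hence the support can be read off from the values of the distribution function.\<close>

lemma gev_cdf_in_unit_iff: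
  assumes "\<xi> \<noteq> 0" "0 < \<sigma>"
  shows "gev_cdf \<xi> \<sigma> m z \<in> {0<..<1} \<longleftrightarrow> 0 < sgn \<xi> * (z - (m - \<sigma> / \<xi>))"
proof -
  define r where "r = sgn \<xi> * (z - (m - \<sigma> / \<xi>))"
  have "z = m - \<sigma> / \<xi> + sgn \<xi> * r" using assms by (auto simp: r_def sgn_if)
  moreover have "0 < (\<bar>\<xi>\<bar> / \<sigma> * r) powr (- 1 / \<xi>)" if "0 < r" using that assms by simp
  ultimately show ?thesis using gev_cdf_endpoint[OF assms, of m r] unfolding r_def[symmetric] by auto
qed

text \<open>Equal supports give the sign of the shape and the endpoint; comparing exponents at two
  distances from the endpoint then gives the ratio of scale to shape and the shape itself.\<close>

lemma gev_cdf_inject: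
  assumes s: "s \<noteq> 0" "s' \<noteq> 0" and \<sigma>: "0 < \<sigma>" "0 < \<sigma>'"
    and eq: "\<And>z. gev_cdf s \<sigma> m z = gev_cdf s' \<sigma>' m' z"
  shows "s = s'" "\<sigma> = \<sigma>'" "m = m'"
proof -
  define e e' where "e = m - \<sigma> / s" and "e' = m' - \<sigma>' / s'"
  have supp: "0 < sgn s * (z - e) \<longleftrightarrow> 0 < sgn s' * (z - e')" for z
    using gev_cdf_in_unit_iff[OF s(1) \<sigma>(1), of m z] gev_cdf_in_unit_iff[OF s(2) \<sigma>(2), of m' z]
    by (simp add: eq e_def e'_def)
  have sgn: "sgn s = sgn s'"
    \<comment> \<open>A point above both endpoints lies in a support exactly when the shape is
      positive.\<close>
    using supp[of "max e e' + 1"] s by (auto simp: sgn_if max_def split: if_splits)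
  have e: "e = e'"
    \<comment> \<open>An endpoint is outside its own open support, hence outside the other one; this
      bounds \<open>e - e'\<close> from both sides.\<close>
    using supp[of e] supp[of e'] s unfolding sgn by (auto simp: sgn_if split: if_splits)
  have pw: "(\<bar>s\<bar> / \<sigma> * r) powr (- 1 / s) = (\<bar>s'\<bar> / \<sigma>' * r) powr (- 1 / s')" if r: "0 < r" for r
    using gev_cdf_endpoint[OF s(1) \<sigma>(1), of m r] gev_cdf_endpoint[OF s(2) \<sigma>(2), of m' r]
      eq[of "e + sgn s * r"] r
    by (simp add: e_def[symmetric] e'_def[symmetric] sgn e)
  \<comment> \<open>The distance \<open>\<sigma> / \<bar>s\<bar>\<close> makes the base on the left
    equal to 1, which forces base 1 on the right.\<close>
  have "(\<bar>s'\<bar> / \<sigma>' * (\<sigma> / \<bar>s\<bar>)) powr (- 1 / s') = 1"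
    using pw[of "\<sigma> / \<bar>s\<bar>"] s \<sigma> by simp
  then have "\<bar>s'\<bar> / \<sigma>' * (\<sigma> / \<bar>s\<bar>) = 1" using s \<sigma> by (simp add: powr_def)
  then have ratio: "\<bar>s'\<bar> / \<sigma>' = \<bar>s\<bar> / \<sigma>" using s \<sigma> by (simp add: field_simps)
  \<comment> \<open>Doubling that distance makes both bases 2, so the exponents can be
    compared.\<close>
  have "(2::real) powr (- 1 / s) = 2 powr (- 1 / s')"
    using pw[of "2 * (\<sigma> / \<bar>s\<bar>)"] s \<sigma> by (simp add: ratio)
  then show ss: "s = s'" using s by (simp add: powr_inj)
  show "\<sigma> = \<sigma>'" using ratio s \<sigma> ss by (simp add: field_simps)
  then show "m = m'" using e ss by (simp add: e_def e'_def)
qed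

text \<open>This is max-stability: \<theta> equals
  \<open>(\<theta> powr (- \<xi>)) powr (- 1 / \<xi>)\<close>, so the factor enters the base and
  only changes the scale. The location is the endpoint \<open>b\<close> plus scale over
  shape.\<close>

lemma std_ev_cdf_powr_eq_gev_cdf:
  assumes \<xi>: "\<xi> \<noteq> 0" and \<theta>: "0 < \<theta>" and c: "0 < c"
  shows "std_ev_cdf \<xi> ((z - b) / c) powr \<theta> =
    gev_cdf \<xi> (\<bar>\<xi>\<bar> * c * \<theta> powr \<xi>) (b + sgn \<xi> * c * \<theta> powr \<xi>) z"
proof -
  define \<sigma> where "\<sigma> = \<bar>\<xi>\<bar> * c * \<theta> powr \<xi>"
  define r where "r = sgn \<xi> * (z - b) / c"
  have \<sigma>: "0 < \<sigma>" using assms by (simp add: \<sigma>_def)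
  have t: "(z - b) / c = sgn \<xi> * r" using \<xi> by (auto simp: r_def sgn_if)
  have m: "b + sgn \<xi> * c * \<theta> powr \<xi> - \<sigma> / \<xi> = b"
    using \<xi> by (auto simp: \<sigma>_def sgn_if abs_if)
  have z: "z = b + sgn \<xi> * (c * r)" using \<xi> c by (auto simp: r_def sgn_if)
  have "(\<bar>\<xi>\<bar> / \<sigma> * (c * r)) powr (- 1 / \<xi>) = \<theta> * r powr (- 1 / \<xi>)" if "0 < r"
  proof -
    have "\<bar>\<xi>\<bar> / \<sigma> * (c * r) = \<theta> powr (- \<xi>) * r"
      using \<xi> c \<theta> by (simp add: \<sigma>_def powr_minus field_simps)
    then have "(\<bar>\<xi>\<bar> / \<sigma> * (c * r)) powr (- 1 / \<xi>) = (\<theta> powr (- \<xi>)) powr (- 1 / \<xi>) * r powr (- 1 / \<xi>)"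
      by (simp add: powr_mult)
    then show ?thesis using \<xi> \<theta> by (simp add: powr_powr)
  qed
  then show ?thesis
    using gev_cdf_endpoint[OF \<xi> \<sigma>, of "b + sgn \<xi> * c * \<theta> powr \<xi>" "c * r"] c
      std_ev_cdf_powr[OF \<xi> \<theta>, of r]
    unfolding m z[symmetric] t \<sigma>_def[symmetric] by (simp add: zero_less_mult_iff)
qed

section \<open>Uniqueness of the limit law of a normalised process\<close>

lemma (in prob_space) cdf_of_mono:
  assumes "Z \<in> borel_measurable M" "z \<le> z'"
  shows "cdf_of M Z z \<le> cdf_of M Z z'"
proof -
  have "{x \<in> space M. Z x \<le> z'} \<in> sets M" using assms(1) by measurable
  then show ?thesis unfolding cdf_of_def using assms(2) by (intro finite_measure_mono) auto
qed

text \<open>The two types are tested on disjoint ranges of \<open>t\<close>, so their limits cannot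
  be compared pointwise. Monotonicity carries the Weibull limit 1 at \<open>t = 0\<close> over to
  \<open>t = 1\<close>, where a Frechet limit is below 1.\<close>

lemma (in prob_space) max_limit_law_sgn:
  assumes Z: "\<And>n. Z n \<in> borel_measurable M"
    and "max_limit_law M Z c b \<xi> \<theta>" "max_limit_law M Z c b \<xi>' \<theta>'"
  shows "0 < \<xi>' \<Longrightarrow> 0 < \<xi>"
proof (rule ccontr)
  assume pos: "0 < \<xi>'" and "\<not> 0 < \<xi>"
  with assms have neg: "\<xi> < 0" by (simp add: max_limit_law_def)
  have "(\<lambda>n. cdf_of M (Z n) (c n * 0 + b)) \<longlonglongrightarrow> std_ev_cdf \<xi> 0 powr \<theta>"
    using assms(2) neg unfolding max_limit_law_def ev_range_def by (elim conjE bspec) auto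
  then have 0: "(\<lambda>n. cdf_of M (Z n) (c n * 0 + b)) \<longlonglongrightarrow> 1" using neg by (simp add: std_ev_cdf_def)
  have 1: "(\<lambda>n. cdf_of M (Z n) (c n * 1 + b)) \<longlonglongrightarrow> std_ev_cdf \<xi>' 1 powr \<theta>'"
    using assms(3) pos unfolding max_limit_law_def ev_range_def by (elim conjE bspec) auto
  have "c n * 0 + b \<le> c n * 1 + b" for n
    using assms(2) by (simp add: max_limit_law_def less_imp_le)
  then have "1 \<le> std_ev_cdf \<xi>' 1 powr \<theta>'"
    by (intro LIMSEQ_le[OF 0 1] exI allI impI cdf_of_mono[OF Z])
  then show False using pos assms(3) by (simp add: std_ev_cdf_def powr_def max_limit_law_def)
qed

text \<open>Once the signs of the shapes agree, both laws are limits of the same sequences on the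
  same range. At \<open>r = 1\<close> the power is 1 and \<theta> is isolated; \<open>r = 2\<close>
  then determines \<xi>.\<close>

lemma (in prob_space) max_limit_law_unique:
  assumes Z: "\<And>n. Z n \<in> borel_measurable M"
    and L: "max_limit_law M Z c b \<xi> \<theta>" and L': "max_limit_law M Z c b \<xi>' \<theta>'"
  shows "\<xi> = \<xi>'" "\<theta> = \<theta>'"
proof -
  have nz: "\<xi> \<noteq> 0" "\<xi>' \<noteq> 0" "0 < \<theta>" "0 < \<theta>'" using L L' by (auto simp: max_limit_law_def)
  have sgn: "0 < \<xi> \<longleftrightarrow> 0 < \<xi>'"
    using max_limit_law_sgn[OF Z L L'] max_limit_law_sgn[OF Z L' L] by blast
  then have sgn': "sgn \<xi> = sgn \<xi>'" using nz by (auto simp: sgn_if)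
  have e: "\<theta> * r powr (- 1 / \<xi>) = \<theta>' * r powr (- 1 / \<xi>')" if r: "0 < r" for r
  proof -
    have "sgn \<xi> * r \<in> ev_range \<xi>" "sgn \<xi> * r \<in> ev_range \<xi>'"
      using r nz sgn by (auto simp: ev_range_def sgn_if)
    then have "std_ev_cdf \<xi> (sgn \<xi> * r) powr \<theta> = std_ev_cdf \<xi>' (sgn \<xi> * r) powr \<theta>'"
      using L L' unfolding max_limit_law_def by (blast intro: LIMSEQ_unique)
    then show ?thesis
      using std_ev_cdf_powr[of \<xi> \<theta> r] std_ev_cdf_powr[of \<xi>' \<theta>' r] nz r by (simp add: sgn')
  qed
  show "\<theta> = \<theta>'" using e[of 1] by simp
  then show "\<xi> = \<xi>'" using e[of 2] nz by (simp add: powr_inj)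
qed

section \<open>From exponential limits to explicit GEV parameters\<close>

text \<open>The substitution \<open>t = sgn \<xi> * \<tau> powr (- \<xi>)\<close> reaches every test
  point except the Weibull endpoint \<open>t = 0\<close>, the limit of \<tau> tending to 0, which is
  supplied by monotonicity.\<close>

lemma (in prob_space) max_limit_law_if_exp_limit:
  assumes Z: "\<And>n. Z n \<in> borel_measurable M" and \<xi>: "\<xi> \<noteq> 0" and \<theta>: "0 < \<theta>" "\<theta> \<le> 1"
    and c: "\<And>n. 0 < c n"
    and lim: "\<And>\<tau>. 0 < \<tau> \<Longrightarrow>
      (\<lambda>n. cdf_of M (Z n) (c n * (sgn \<xi> * \<tau> powr (- \<xi>)) + b)) \<longlonglongrightarrow> exp (- \<theta> * \<tau>)"
  shows "max_limit_law M Z c b \<xi> \<theta>"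
proof -
  have "(\<lambda>n. cdf_of M (Z n) (c n * t + b)) \<longlonglongrightarrow> std_ev_cdf \<xi> t powr \<theta>"
    if t: "t \<in> ev_range \<xi>" for t
  proof (cases "t = 0")
    case True
    then have neg: "\<xi> < 0" using t \<xi> by (auto simp: ev_range_def split: if_splits)
    have "(\<lambda>n. cdf_of M (Z n) b) \<longlonglongrightarrow> 1"
    proof (rule order_tendstoI)
      fix y :: real assume y: "y < 1"
      \<comment> \<open>Small enough that \<open>exp (- \<theta> * \<tau>) \<ge> 1 - \<theta> *
        \<tau> \<ge> 1 - \<tau> > y\<close>. The threshold for this \<tau> lies below
        \<open>b\<close>, so the values at \<open>b\<close> eventually exceed \<open>y\<close> as
        well.\<close>
      define \<tau> where "\<tau> = (1 - y) / 2"
      have \<tau>: "0 < \<tau>" "y < 1 - \<tau>" using y by (auto simp: \<tau>_def field_simps)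
      have "\<theta> * \<tau> \<le> \<tau>" using \<theta> \<tau> by (intro mult_left_le_one_le) auto
      then have y': "y < exp (- \<theta> * \<tau>)"
        using exp_ge_add_one_self[of "- \<theta> * \<tau>"] \<tau> by linarith
      have "c n * (sgn \<xi> * \<tau> powr (- \<xi>)) + b \<le> b" for n
        using c[of n] neg by simp
      from cdf_of_mono[OF Z this]
      have "cdf_of M (Z n) (c n * (sgn \<xi> * \<tau> powr (- \<xi>)) + b) \<le> cdf_of M (Z n) b" for n .
      with order_tendstoD(1)[OF lim[OF \<tau>(1)] y']
      show "\<forall>\<^sub>F n in sequentially. y < cdf_of M (Z n) b"
        by (auto elim!: eventually_mono intro: less_le_trans)
    next
      fix y :: real assume "1 < y"
      then show "\<forall>\<^sub>F n in sequentially. cdf_of M (Z n) b < y"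
        by (intro always_eventually allI) (auto simp: cdf_of_def intro: le_less_trans[OF prob_le_1])
    qed
    then show ?thesis using True neg by (simp add: std_ev_cdf_def)
  next
    case False
    define r where "r = \<bar>t\<bar>"
    have r: "0 < r" and tr: "t = sgn \<xi> * r"
      using False t \<xi> by (auto simp: r_def ev_range_def sgn_if split: if_splits)
    \<comment> \<open>The choice \<open>\<tau> = r powr (- 1 / \<xi>)\<close> inverts the
      substitution.\<close>
    have "(r powr (- 1 / \<xi>)) powr (- \<xi>) = r" using \<xi> r by (simp add: powr_powr)
    then show ?thesis
      using lim[of "r powr (- 1 / \<xi>)"] std_ev_cdf_powr[OF \<xi> \<theta>(1), of r] r by (simp add: tr)
  qed
  then show ?thesis unfolding max_limit_law_def using \<xi> \<theta> c by blast
qed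

text \<open>Uniqueness of the limit law removes the existential quantifier in
  \<open>gev_params\<close>, and identifiability of GEV laws turns equality of distribution
  functions into equality of triples.\<close>

lemma (in prob_space) gev_params_iff:
  assumes Z: "\<And>n. Z n \<in> borel_measurable M" and L: "max_limit_law M Z c b \<xi> \<theta>"
  shows "gev_params M Z c b n p \<longleftrightarrow>
    p = (\<xi>, \<bar>\<xi>\<bar> * c n * \<theta> powr \<xi>, b + sgn \<xi> * c n * \<theta> powr \<xi>)"
proof -
  have pos: "\<xi> \<noteq> 0" "0 < \<theta>" "0 < c n" "0 < \<bar>\<xi>\<bar> * c n * \<theta> powr \<xi>"
    using L by (auto simp: max_limit_law_def)
  note G = std_ev_cdf_powr_eq_gev_cdf[OF pos(1-3), of _ b]
  obtain s \<sigma> m where p: "p = (s, \<sigma>, m)" by (cases p)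
  have "gev_params M Z c b n p \<longleftrightarrow> s \<noteq> 0 \<and> 0 < \<sigma> \<and>
      (\<forall>z. gev_cdf \<xi> (\<bar>\<xi>\<bar> * c n * \<theta> powr \<xi>) (b + sgn \<xi> * c n * \<theta> powr \<xi>) z = gev_cdf s \<sigma> m z)"
  proof -
    have "max_limit_law M Z c b \<xi>' \<theta>' \<longleftrightarrow> \<xi>' = \<xi> \<and> \<theta>' = \<theta>" for \<xi>' \<theta>'
      using L max_limit_law_unique[OF Z L] by blast
    then show ?thesis by (simp add: gev_params_def p G)
  qed
  also have "\<dots> \<longleftrightarrow> p = (\<xi>, \<bar>\<xi>\<bar> * c n * \<theta> powr \<xi>, b + sgn \<xi> * c n * \<theta> powr \<xi>)"
    using gev_cdf_inject[OF pos(1) _ pos(4), of s \<sigma> _ m] pos unfolding p by auto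
  finally show ?thesis .
qed

section \<open>Measurability of the window functionals and maxima\<close>

context ergodic_system
begin

lemma funpow_measurable [measurable]: "T ^^ j \<in> measurable P P"
  by (rule measurable_compose_n[OF T_measurable])

lemma window_measurable:
  assumes [measurable]: "\<phi> \<in> borel_measurable P"
  shows "window_min T \<phi> k \<in> borel_measurable P" "window_mean T \<phi> k \<in> borel_measurable P"
  unfolding window_min_def[abs_def] window_mean_def[abs_def] by measurable

lemma maxima_measurable:
  assumes [measurable]: "\<phi> \<in> borel_measurable P"
  shows "orbit_max T \<phi> n \<in> borel_measurable P" "window_max T \<phi> n \<in> borel_measurable P"
  unfolding orbit_max_def[abs_def] window_max_def[abs_def] by measurable

end

section \<open>Comparison of the parameters of the two maxima\<close>

theorem lemma4p1:
  fixes P :: "'a measure" and T :: "'a \<Rightarrow> 'a" and \<phi> Y :: "'a \<Rightarrow> real" and k :: nat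
    and \<theta>\<^sub>1 \<theta>\<^sub>2 g \<xi>\<^sub>1 C :: real and a \<alpha> :: "nat \<Rightarrow> real" and u w :: "nat \<Rightarrow> real \<Rightarrow> real"
  assumes "ergodic_system P T"
    and "\<phi> \<in> borel_measurable P"
    and "k \<ge> 1"
    and "Y = window_min T \<phi> k \<or> Y = window_mean T \<phi> k"
    and "0 < \<theta>\<^sub>1" "\<theta>\<^sub>1 \<le> 1" "0 < \<theta>\<^sub>2" "\<theta>\<^sub>2 \<le> 1"
    and "0 < g"
    and "\<And>n. 0 < a n"
    and "\<And>\<tau>. 0 < \<tau> \<Longrightarrow> (\<lambda>n. cdf_of P (orbit_max T \<phi> n) (u n \<tau>)) \<longlonglongrightarrow> exp (- \<theta>\<^sub>1 * \<tau>)"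
    and "\<And>\<tau>. 0 < \<tau> \<Longrightarrow> (\<lambda>n. cdf_of P (window_max T Y n) (w n \<tau>)) \<longlonglongrightarrow> exp (- \<theta>\<^sub>2 * \<tau>)"
  shows
    "(0 < \<xi>\<^sub>1 \<and> has_ev_type P \<phi> \<xi>\<^sub>1 \<and>
      (\<forall>n. \<forall>\<tau>>0. u n \<tau> = a n * \<tau> powr (- \<xi>\<^sub>1)) \<and>
      (\<forall>n. \<forall>\<tau>>0. w n \<tau> = g * u n \<tau>)
      \<longrightarrow> (\<forall>n\<ge>2.
        (\<exists>!p. gev_params P (orbit_max T \<phi>) a 0 n p) \<and>
        (\<exists>!p. gev_params P (window_max T Y) (\<lambda>n. g * a n) 0 n p) \<and>
        (\<forall>s\<^sub>1 \<sigma>\<^sub>1 \<mu>\<^sub>1 \<xi>\<^sub>2 \<sigma>\<^sub>2 \<mu>\<^sub>2.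
          gev_params P (orbit_max T \<phi>) a 0 n (s\<^sub>1, \<sigma>\<^sub>1, \<mu>\<^sub>1) \<and>
          gev_params P (window_max T Y) (\<lambda>n. g * a n) 0 n (\<xi>\<^sub>2, \<sigma>\<^sub>2, \<mu>\<^sub>2) \<longrightarrow>
            s\<^sub>1 = \<xi>\<^sub>1 \<and> \<xi>\<^sub>2 = \<xi>\<^sub>1 \<and>
            \<mu>\<^sub>2 = g * \<mu>\<^sub>1 * (\<theta>\<^sub>2 / \<theta>\<^sub>1) powr \<xi>\<^sub>1 \<and>
            \<sigma>\<^sub>2 = g * \<sigma>\<^sub>1 * (\<theta>\<^sub>2 / \<theta>\<^sub>1) powr \<xi>\<^sub>1)))
     \<and>
     (\<xi>\<^sub>1 < 0 \<and> has_ev_type P \<phi> \<xi>\<^sub>1 \<and>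
      bdd_above (\<phi> ` space P) \<and> C = Sup (\<phi> ` space P) \<and>
      (\<forall>n. \<alpha> n = g * a n) \<and>
      (\<forall>n. \<forall>\<tau>>0. u n \<tau> = a n * (- (\<tau> powr (- \<xi>\<^sub>1))) + C) \<and>
      (\<forall>n. \<forall>\<tau>>0. w n \<tau> = \<alpha> n * (- (\<tau> powr (- \<xi>\<^sub>1))) + C)
      \<longrightarrow> (\<forall>n\<ge>2.
        (\<exists>!p. gev_params P (orbit_max T \<phi>) a C n p) \<and>
        (\<exists>!p. gev_params P (window_max T Y) \<alpha> C n p) \<and>
        (\<forall>s\<^sub>1 \<sigma>\<^sub>1 \<mu>\<^sub>1 \<xi>\<^sub>2 \<sigma>\<^sub>2 \<mu>\<^sub>2.
          gev_params P (orbit_max T \<phi>) a C n (s\<^sub>1, \<sigma>\<^sub>1, \<mu>\<^sub>1) \<and>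
          gev_params P (window_max T Y) \<alpha> C n (\<xi>\<^sub>2, \<sigma>\<^sub>2, \<mu>\<^sub>2) \<longrightarrow>
            s\<^sub>1 = \<xi>\<^sub>1 \<and> \<xi>\<^sub>2 = \<xi>\<^sub>1 \<and>
            \<mu>\<^sub>2 = \<sigma>\<^sub>1 / \<xi>\<^sub>1 * (g - 1) + \<mu>\<^sub>1 - g * \<sigma>\<^sub>1 / \<xi>\<^sub>1 * (1 - (\<theta>\<^sub>2 / \<theta>\<^sub>1) powr \<xi>\<^sub>1) \<and>
            \<sigma>\<^sub>2 = g * \<sigma>\<^sub>1 * (\<theta>\<^sub>2 / \<theta>\<^sub>1) powr \<xi>\<^sub>1)))"
proof -
  interpret ergodic_system P T by fact
  note \<phi> = assms(2) and \<theta> = assms(5-8) and g = assms(9) and a = assms(10)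
    and limM = assms(11) and limB = assms(12)
  have Y: "Y \<in> borel_measurable P" using assms(4) window_measurable[OF \<phi>] by auto
  note M = maxima_measurable(1)[OF \<phi>] and B = maxima_measurable(2)[OF Y]
  have ga: "0 < g * a n" for n using g a by simp
  have r: "\<theta>\<^sub>1 powr \<xi>\<^sub>1 * (\<theta>\<^sub>2 / \<theta>\<^sub>1) powr \<xi>\<^sub>1 = \<theta>\<^sub>2 powr \<xi>\<^sub>1"
    using \<theta> by (simp add: powr_divide)
  \<comment> \<open>Both cases at once: \<open>b\<close> is 0 for Frechet and \<open>C\<close> for
    Weibull. The second triple is written through the first, with
    \<open>(\<theta>\<^sub>2 / \<theta>\<^sub>1) powr \<xi>\<^sub>1\<close> converting one scale
    into the other.\<close>
  have params:
    "gev_params P (orbit_max T \<phi>) a b n p \<longleftrightarrow>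
      p = (\<xi>\<^sub>1, \<bar>\<xi>\<^sub>1\<bar> * a n * \<theta>\<^sub>1 powr \<xi>\<^sub>1, b + sgn \<xi>\<^sub>1 * a n * \<theta>\<^sub>1 powr \<xi>\<^sub>1)"
    "gev_params P (window_max T Y) (\<lambda>n. g * a n) b n p \<longleftrightarrow>
      p = (\<xi>\<^sub>1, g * (\<bar>\<xi>\<^sub>1\<bar> * a n * \<theta>\<^sub>1 powr \<xi>\<^sub>1) * (\<theta>\<^sub>2 / \<theta>\<^sub>1) powr \<xi>\<^sub>1,
             b + g * (sgn \<xi>\<^sub>1 * a n * \<theta>\<^sub>1 powr \<xi>\<^sub>1) * (\<theta>\<^sub>2 / \<theta>\<^sub>1) powr \<xi>\<^sub>1)"
    if \<xi>: "\<xi>\<^sub>1 \<noteq> 0"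
      and u: "\<And>n \<tau>. 0 < \<tau> \<Longrightarrow> u n \<tau> = a n * (sgn \<xi>\<^sub>1 * \<tau> powr (- \<xi>\<^sub>1)) + b"
      and w: "\<And>n \<tau>. 0 < \<tau> \<Longrightarrow> w n \<tau> = g * a n * (sgn \<xi>\<^sub>1 * \<tau> powr (- \<xi>\<^sub>1)) + b"
    for b n p
  proof -
    have "max_limit_law P (orbit_max T \<phi>) a b \<xi>\<^sub>1 \<theta>\<^sub>1"
      by (rule max_limit_law_if_exp_limit[OF M \<xi> \<theta>(1,2) a]) (use limM u in simp)
    from gev_params_iff[OF M this]
    show "gev_params P (orbit_max T \<phi>) a b n p \<longleftrightarrow>
      p = (\<xi>\<^sub>1, \<bar>\<xi>\<^sub>1\<bar> * a n * \<theta>\<^sub>1 powr \<xi>\<^sub>1, b + sgn \<xi>\<^sub>1 * a n * \<theta>\<^sub>1 powr \<xi>\<^sub>1)" .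
    have "max_limit_law P (window_max T Y) (\<lambda>n. g * a n) b \<xi>\<^sub>1 \<theta>\<^sub>2"
      by (rule max_limit_law_if_exp_limit[OF B \<xi> \<theta>(3,4) ga]) (use limB w in simp)
    from gev_params_iff[OF B this]
    show "gev_params P (window_max T Y) (\<lambda>n. g * a n) b n p \<longleftrightarrow>
      p = (\<xi>\<^sub>1, g * (\<bar>\<xi>\<^sub>1\<bar> * a n * \<theta>\<^sub>1 powr \<xi>\<^sub>1) * (\<theta>\<^sub>2 / \<theta>\<^sub>1) powr \<xi>\<^sub>1,
             b + g * (sgn \<xi>\<^sub>1 * a n * \<theta>\<^sub>1 powr \<xi>\<^sub>1) * (\<theta>\<^sub>2 / \<theta>\<^sub>1) powr \<xi>\<^sub>1)"
      by (simp add: r[symmetric] mult_ac)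
  qed
  show ?thesis
  proof (intro conjI impI; elim conjE)
    assume "0 < \<xi>\<^sub>1" "\<forall>n. \<forall>\<tau>>0. u n \<tau> = a n * \<tau> powr (- \<xi>\<^sub>1)"
      "\<forall>n. \<forall>\<tau>>0. w n \<tau> = g * u n \<tau>"
    then have "gev_params P (orbit_max T \<phi>) a 0 n p \<longleftrightarrow>
        p = (\<xi>\<^sub>1, \<xi>\<^sub>1 * a n * \<theta>\<^sub>1 powr \<xi>\<^sub>1, a n * \<theta>\<^sub>1 powr \<xi>\<^sub>1)"
      "gev_params P (window_max T Y) (\<lambda>n. g * a n) 0 n p \<longleftrightarrow>
        p = (\<xi>\<^sub>1, g * (\<xi>\<^sub>1 * a n * \<theta>\<^sub>1 powr \<xi>\<^sub>1) * (\<theta>\<^sub>2 / \<theta>\<^sub>1) powr \<xi>\<^sub>1,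
               g * (a n * \<theta>\<^sub>1 powr \<xi>\<^sub>1) * (\<theta>\<^sub>2 / \<theta>\<^sub>1) powr \<xi>\<^sub>1)" for n p
      using params[of 0 n p] by simp_all
    \<comment> \<open>As rewrite rules these make the unique existence claims trivial and reduce the
      relations to identities between explicit triples.\<close>
    note [simp] = this
    show "\<forall>n\<ge>2. (\<exists>!p. gev_params P (orbit_max T \<phi>) a 0 n p) \<and>
        (\<exists>!p. gev_params P (window_max T Y) (\<lambda>n. g * a n) 0 n p) \<and>
        (\<forall>s\<^sub>1 \<sigma>\<^sub>1 \<mu>\<^sub>1 \<xi>\<^sub>2 \<sigma>\<^sub>2 \<mu>\<^sub>2.
          gev_params P (orbit_max T \<phi>) a 0 n (s\<^sub>1, \<sigma>\<^sub>1, \<mu>\<^sub>1) \<and>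
          gev_params P (window_max T Y) (\<lambda>n. g * a n) 0 n (\<xi>\<^sub>2, \<sigma>\<^sub>2, \<mu>\<^sub>2) \<longrightarrow>
            s\<^sub>1 = \<xi>\<^sub>1 \<and> \<xi>\<^sub>2 = \<xi>\<^sub>1 \<and>
            \<mu>\<^sub>2 = g * \<mu>\<^sub>1 * (\<theta>\<^sub>2 / \<theta>\<^sub>1) powr \<xi>\<^sub>1 \<and>
            \<sigma>\<^sub>2 = g * \<sigma>\<^sub>1 * (\<theta>\<^sub>2 / \<theta>\<^sub>1) powr \<xi>\<^sub>1)"
      by auto
  next
    assume neg: "\<xi>\<^sub>1 < 0" and \<alpha>: "\<forall>n. \<alpha> n = g * a n"
      and u: "\<forall>n. \<forall>\<tau>>0. u n \<tau> = a n * (- (\<tau> powr (- \<xi>\<^sub>1))) + C"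
      and w: "\<forall>n. \<forall>\<tau>>0. w n \<tau> = \<alpha> n * (- (\<tau> powr (- \<xi>\<^sub>1))) + C"
    have \<alpha>: "\<alpha> = (\<lambda>n. g * a n)" using \<alpha> by auto
    have "gev_params P (orbit_max T \<phi>) a C n p \<longleftrightarrow>
        p = (\<xi>\<^sub>1, - \<xi>\<^sub>1 * a n * \<theta>\<^sub>1 powr \<xi>\<^sub>1, C - a n * \<theta>\<^sub>1 powr \<xi>\<^sub>1)"
      "gev_params P (window_max T Y) \<alpha> C n p \<longleftrightarrow>
        p = (\<xi>\<^sub>1, - g * (\<xi>\<^sub>1 * a n * \<theta>\<^sub>1 powr \<xi>\<^sub>1) * (\<theta>\<^sub>2 / \<theta>\<^sub>1) powr \<xi>\<^sub>1,
               C - g * (a n * \<theta>\<^sub>1 powr \<xi>\<^sub>1) * (\<theta>\<^sub>2 / \<theta>\<^sub>1) powr \<xi>\<^sub>1)" for n p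
      using params[of C n p] neg u w by (simp_all add: \<alpha>)
    note [simp] = this
    show "\<forall>n\<ge>2. (\<exists>!p. gev_params P (orbit_max T \<phi>) a C n p) \<and>
        (\<exists>!p. gev_params P (window_max T Y) \<alpha> C n p) \<and>
        (\<forall>s\<^sub>1 \<sigma>\<^sub>1 \<mu>\<^sub>1 \<xi>\<^sub>2 \<sigma>\<^sub>2 \<mu>\<^sub>2.
          gev_params P (orbit_max T \<phi>) a C n (s\<^sub>1, \<sigma>\<^sub>1, \<mu>\<^sub>1) \<and>
          gev_params P (window_max T Y) \<alpha> C n (\<xi>\<^sub>2, \<sigma>\<^sub>2, \<mu>\<^sub>2) \<longrightarrow>
            s\<^sub>1 = \<xi>\<^sub>1 \<and> \<xi>\<^sub>2 = \<xi>\<^sub>1 \<and>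
            \<mu>\<^sub>2 = \<sigma>\<^sub>1 / \<xi>\<^sub>1 * (g - 1) + \<mu>\<^sub>1 - g * \<sigma>\<^sub>1 / \<xi>\<^sub>1 * (1 - (\<theta>\<^sub>2 / \<theta>\<^sub>1) powr \<xi>\<^sub>1) \<and>
            \<sigma>\<^sub>2 = g * \<sigma>\<^sub>1 * (\<theta>\<^sub>2 / \<theta>\<^sub>1) powr \<xi>\<^sub>1)"
      \<comment> \<open>Both laws have the endpoint
        \<open>C = \<mu>\<^sub>1 - \<sigma>\<^sub>1 / \<xi>\<^sub>1\<close>, and the formula for
        \<open>\<mu>\<^sub>2\<close> is \<open>C + \<sigma>\<^sub>2 / \<xi>\<^sub>1\<close>
        rearranged.\<close>
      using neg by (auto simp: field_simps)
  qed
qed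

end
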